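(* Let $X$ be a topological space and let $\mathcal{P}(X)$ be its power set ring. Then $X$ is Hausdorff if and only if every maximal ideal of $\mathcal{P}(X)$ converges to at most one point of $X$.
   Context: For a set $X$, the power set ring $\mathcal{P}(X)$ is the commutative ring whose elements are the subsets of $X$, with addition the symmetric difference $A+B=(A\cup B)\setminus(A\cap B)$ and multiplication $A\cdot B=A\cap B$; its zero is $\emptyset$ and its unit is $X$. If $X$ is a topological space, $x\in X$ and $M$ is a maximal ideal of $\mathcal{P}(X)$, then $M$ is said to be convergent to (or to converge to) $x$ if for every open subset $U$ of $X$ containing $x$ one has $U\notin M$. *)

theory Defs
  imports "HOL-Analysis.T1_Spaces" "HOL-Algebra.Ideal"
begin

definition power_set_ring :: "'a set \<Rightarrow> 'a set ring"
  where "power_set_ring X =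
    \<lparr>carrier = Pow X, mult = (\<inter>), one = X, zero = {}, add = (\<lambda>A B. (A \<union> B) - (A \<inter> B))\<rparr>"

lemma power_set_ring_cring: "cring (power_set_ring X)"
proof (rule cringI)
  show "abelian_group (power_set_ring X)"
    by (rule abelian_groupI) (auto simp: power_set_ring_def)
  show "Group.comm_monoid (power_set_ring X)"
    by (rule comm_monoidI) (auto simp: power_set_ring_def)
qed (auto simp: power_set_ring_def)

text \<open>Convergence is only meant for maximal ideals M of the power set ring of \<open>topspace X\<close>;
  the limit is required to be a point of the space, since for other x the condition on
  open neighbourhoods would hold vacuously.\<close>

definition ideal_converges_to :: "'a topology \<Rightarrow> 'a set set \<Rightarrow> 'a \<Rightarrow> bool"
  where "ideal_converges_to X M x \<longleftrightarrow>
    x \<in> topspace X \<and> (\<forall>U. openin X U \<and> x \<in> U \<longrightarrow> U \<notin> M)"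

end

theory Submission
  imports Defs
begin

text \<open>Ideals of the power set ring are dual to filters: \<open>A \<mapsto> X - A\<close> turns an ideal into a filter and
  a maximal ideal into an ultrafilter, and convergence becomes the usual convergence of ultrafilters.

  In a Hausdorff space, distinct points have disjoint open neighbourhoods \<open>U\<close> and \<open>V\<close>. Their product
  \<open>U \<inter> V = {}\<close> is zero, and a maximal ideal is prime, so every maximal ideal contains \<open>U\<close> or \<open>V\<close>
  and cannot converge to both points.

  Conversely, suppose that every open neighbourhood of \<open>x\<close> meets every open neighbourhood of \<open>y\<close>.
  The sets that miss \<open>U \<inter> V\<close> for some such neighbourhoods \<open>U\<close>, \<open>V\<close> form an ideal
  (\<open>joint_nonneighbourhoods\<close>); it is proper because the whole space misses only the empty
  set. By Krull's theorem (\<open>proper_ideal_subset_maximalideal\<close>) it lies in a maximal ideal.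
  The complement of every open neighbourhood of \<open>x\<close> or \<open>y\<close> is already in that ideal, so no such
  neighbourhood can be added without generating the whole ring.
  Hence the maximal ideal converges to both points.\<close>

text \<open>Krull's theorem: an ideal is proper exactly when it omits \<open>\<one>\<close>, a condition that survives unions
  of chains, so Zorn's lemma applies.\<close>

lemma (in ring) proper_ideal_subset_maximalideal:
  assumes "ideal I R" and "\<one> \<notin> I"
  obtains M where "maximalideal M R" and "I \<subseteq> M"
proof -
  let ?S = "{J. ideal J R \<and> I \<subseteq> J \<and> \<one> \<notin> J}"
  have "\<exists>M\<in>?S. \<forall>J\<in>?S. M \<subseteq> J \<longrightarrow> J = M"
  proof (rule subset_Zorn_nonempty)
    show "?S \<noteq> {}" using assms by blast
  next
    fix C assume "C \<noteq> {}" and chain: "subset.chain ?S C"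
    have C: "ideal J R" "I \<subseteq> J" "\<one> \<notin> J" if "J \<in> C" for J
      using chain that by (auto simp: subset.chain_def)
    have common: "\<exists>J\<in>C. a \<in> J \<and> b \<in> J" if "a \<in> \<Union>C" "b \<in> \<Union>C" for a b
      using chain that unfolding subset.chain_def by blast
    have sub: "additive_subgroup J R" if "J \<in> C" for J
      using C(1)[OF that] by (rule ideal.axioms(1))
    have "ideal (\<Union>C) R"
    proof (rule idealI)
      show "ring R" by (rule ring_axioms)
      show "subgroup (\<Union>C) (add_monoid R)"
      proof (rule add.subgroupI)
        show "\<Union>C \<subseteq> carrier R"
          using additive_subgroup.a_subset[OF sub] by blast
        show "\<Union>C \<noteq> {}"
          using \<open>C \<noteq> {}\<close> additive_subgroup.zero_closed[OF sub] by blast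
        show "\<ominus> a \<in> \<Union>C" if "a \<in> \<Union>C" for a
          using that additive_subgroup.a_inv_closed[OF sub] by blast
        show "a \<oplus> b \<in> \<Union>C" if "a \<in> \<Union>C" "b \<in> \<Union>C" for a b
          using common[OF that] additive_subgroup.a_closed[OF sub] by blast
      qed
      show "x \<otimes> a \<in> \<Union>C" if "a \<in> \<Union>C" "x \<in> carrier R" for a x
        using that ideal.I_l_closed[OF C(1)] by blast
      show "a \<otimes> x \<in> \<Union>C" if "a \<in> \<Union>C" "x \<in> carrier R" for a x
        using that ideal.I_r_closed[OF C(1)] by blast
    qed
    then show "\<Union>C \<in> ?S"
      using \<open>C \<noteq> {}\<close> C(2,3) by blast
  qed
  then obtain M where "M \<in> ?S" and S_max: "\<forall>J\<in>?S. M \<subseteq> J \<longrightarrow> J = M" ..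
  then have M: "ideal M R" "I \<subseteq> M" "\<one> \<notin> M" by simp_all
  have max: "J = M" if "ideal J R" "M \<subseteq> J" "\<one> \<notin> J" for J
    using S_max that M(2) by simp
  have "maximalideal M R"
  proof (rule maximalidealI)
    show "carrier R \<noteq> M" using M(3) by blast
    show "J = M \<or> J = carrier R" if "ideal J R" "M \<subseteq> J" for J
      using max[OF that] ideal.one_imp_carrier[OF that(1)] by blast
  qed (rule M(1))
  then show thesis using M(2) by (rule that)
qed

text \<open>The order-theoretic view of ideals of the power set ring: the symmetric difference is contained
  in the union, and every set is its own additive inverse.\<close>

lemma power_set_ring_idealI:
  assumes "I \<subseteq> Pow X" and "{} \<in> I"
    and down: "\<And>A B. \<lbrakk>A \<in> I; B \<subseteq> A\<rbrakk> \<Longrightarrow> B \<in> I"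
    and un: "\<And>A B. \<lbrakk>A \<in> I; B \<in> I\<rbrakk> \<Longrightarrow> A \<union> B \<in> I"
  shows "ideal I (power_set_ring X)"
proof -
  interpret cring "power_set_ring X" by (rule power_set_ring_cring)
  have inv: "\<ominus>\<^bsub>power_set_ring X\<^esub> A = A" if "A \<subseteq> X" for A
    by (rule minus_equality) (use that in \<open>auto simp: power_set_ring_def\<close>)
  show ?thesis
  proof (rule idealI)
    show "ring (power_set_ring X)" by (rule ring_axioms)
    show "subgroup I (add_monoid (power_set_ring X))"
    proof (rule add.subgroupI)
      show "I \<subseteq> carrier (power_set_ring X)"
        using assms(1) by (simp add: power_set_ring_def)
      show "\<ominus>\<^bsub>power_set_ring X\<^esub> A \<in> I" if "A \<in> I" for A
        using inv that assms(1) by auto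
      show "A \<oplus>\<^bsub>power_set_ring X\<^esub> B \<in> I" if "A \<in> I" "B \<in> I" for A B
        using down[OF un[OF that]] by (auto simp: power_set_ring_def)
    qed (use assms(2) in blast)
  qed (auto simp: power_set_ring_def intro: down)
qed

text \<open>Disjoint sets have product zero, and a maximal ideal is prime.\<close>

lemma maximalideal_power_set_ring_disjoint:
  assumes "maximalideal M (power_set_ring X)" and "A \<subseteq> X" "B \<subseteq> X" "A \<inter> B = {}"
  shows "A \<in> M \<or> B \<in> M"
proof -
  interpret cring "power_set_ring X" by (rule power_set_ring_cring)
  interpret primeideal M "power_set_ring X" by (rule maximalideal_prime[OF assms(1)])
  show ?thesis
    using I_prime[of A B] zero_closed assms(2-4) by (simp add: power_set_ring_def)
qed

text \<open>A set and its complement add up to the unit.\<close>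

lemma maximalideal_power_set_ring_compl:
  assumes "maximalideal M (power_set_ring X)" and "A \<subseteq> X" and "X - A \<in> M"
  shows "A \<notin> M"
proof
  assume "A \<in> M"
  interpret maximalideal M "power_set_ring X" by fact
  have "A \<oplus>\<^bsub>power_set_ring X\<^esub> (X - A) \<in> M"
    using \<open>A \<in> M\<close> assms(3) by (rule additive_subgroup.a_closed[OF is_additive_subgroup])
  moreover have "A \<oplus>\<^bsub>power_set_ring X\<^esub> (X - A) = \<one>\<^bsub>power_set_ring X\<^esub>"
    using assms(2) by (auto simp: power_set_ring_def)
  ultimately show False
    using one_imp_carrier I_notcarr by simp
qed

text \<open>The dual of the filter generated by the neighbourhoods of \<open>x\<close> together with those of \<open>y\<close>. A maximal
  ideal contains it exactly when it converges to both points.\<close>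

definition joint_nonneighbourhoods :: "'a topology \<Rightarrow> 'a \<Rightarrow> 'a \<Rightarrow> 'a set set"
  where "joint_nonneighbourhoods X x y =
    {A. A \<subseteq> topspace X \<and> (\<exists>U V. openin X U \<and> openin X V \<and> x \<in> U \<and> y \<in> V \<and> A \<inter> (U \<inter> V) = {})}"

lemma ideal_joint_nonneighbourhoods:
  assumes "x \<in> topspace X" "y \<in> topspace X"
  shows "ideal (joint_nonneighbourhoods X x y) (power_set_ring (topspace X))"
proof (rule power_set_ring_idealI)
  show "joint_nonneighbourhoods X x y \<subseteq> Pow (topspace X)"
    by (auto simp: joint_nonneighbourhoods_def)
  show "{} \<in> joint_nonneighbourhoods X x y"
    using assms by (auto simp: joint_nonneighbourhoods_def)
  show "B \<in> joint_nonneighbourhoods X x y"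
    if "A \<in> joint_nonneighbourhoods X x y" "B \<subseteq> A" for A B
    using that unfolding joint_nonneighbourhoods_def by blast
next
  fix A B
  assume "A \<in> joint_nonneighbourhoods X x y" "B \<in> joint_nonneighbourhoods X x y"
  then obtain U V U' V' where sub: "A \<subseteq> topspace X" "B \<subseteq> topspace X"
    and "openin X U" "openin X V" "x \<in> U" "y \<in> V" "A \<inter> (U \<inter> V) = {}"
    and "openin X U'" "openin X V'" "x \<in> U'" "y \<in> V'" "B \<inter> (U' \<inter> V') = {}"
    unfolding joint_nonneighbourhoods_def by blast
  then have "openin X (U \<inter> U')" "openin X (V \<inter> V')" "x \<in> U \<inter> U'" "y \<in> V \<inter> V'"
    "(A \<union> B) \<inter> ((U \<inter> U') \<inter> (V \<inter> V')) = {}"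
    by blast+
  with sub show "A \<union> B \<in> joint_nonneighbourhoods X x y"
    unfolding joint_nonneighbourhoods_def by blast
qed

text \<open>The ideal is the whole ring only if the two points can be separated: its unit, the whole space,
  misses \<open>U \<inter> V\<close> only if \<open>U \<inter> V = {}\<close>.\<close>

lemma topspace_in_joint_nonneighbourhoods_iff:
  "topspace X \<in> joint_nonneighbourhoods X x y \<longleftrightarrow>
    (\<exists>U V. openin X U \<and> openin X V \<and> x \<in> U \<and> y \<in> V \<and> disjnt U V)"
proof -
  have "topspace X \<inter> (U \<inter> V) = U \<inter> V" if "openin X U" for U V
    using openin_subset[OF that] by blast
  then show ?thesis
    by (simp add: joint_nonneighbourhoods_def disjnt_def cong: conj_cong)
qed

lemma compl_in_joint_nonneighbourhoods:
  assumes "x \<in> topspace X" "y \<in> topspace X" and "openin X U" and "x \<in> U \<or> y \<in> U"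
  shows "topspace X - U \<in> joint_nonneighbourhoods X x y"
  using assms(4)
proof
  \<comment> \<open>In either case the other point gets the whole space as its neighbourhood.\<close>
  assume "x \<in> U"
  moreover have "(topspace X - U) \<inter> (U \<inter> topspace X) = {}" by blast
  ultimately show ?thesis
    unfolding joint_nonneighbourhoods_def using assms(2,3) openin_topspace[of X] by blast
next
  assume "y \<in> U"
  moreover have "(topspace X - U) \<inter> (topspace X \<inter> U) = {}" by blast
  ultimately show ?thesis
    unfolding joint_nonneighbourhoods_def using assms(1,3) openin_topspace[of X] by blast
qed

lemma maximalideal_converges_to_both:
  assumes "x \<in> topspace X" "y \<in> topspace X"
    and "maximalideal M (power_set_ring (topspace X))"
    and "joint_nonneighbourhoods X x y \<subseteq> M"
  shows "ideal_converges_to X M x" and "ideal_converges_to X M y"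
proof -
  have "U \<notin> M" if "openin X U" "x \<in> U \<or> y \<in> U" for U
    using maximalideal_power_set_ring_compl[OF assms(3)] openin_subset[OF that(1)]
      compl_in_joint_nonneighbourhoods[OF assms(1,2) that] assms(4) by blast
  then show "ideal_converges_to X M x" "ideal_converges_to X M y"
    using assms(1,2) by (auto simp: ideal_converges_to_def)
qed

theorem theorem3p4:
  fixes X :: "'a topology"
  shows "Hausdorff_space X \<longleftrightarrow>
    (\<forall>M. maximalideal M (power_set_ring (topspace X)) \<longrightarrow>
      (\<forall>x y. ideal_converges_to X M x \<and> ideal_converges_to X M y \<longrightarrow> x = y))"
proof (intro iffI allI impI)
  fix M x y
  assume "Hausdorff_space X" and max: "maximalideal M (power_set_ring (topspace X))"
    and conv: "ideal_converges_to X M x \<and> ideal_converges_to X M y"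
  show "x = y"
  proof (rule ccontr)
    assume "x \<noteq> y"
    moreover have "x \<in> topspace X" "y \<in> topspace X"
      using conv by (simp_all add: ideal_converges_to_def)
    ultimately obtain U V
      where UV: "openin X U" "openin X V" "x \<in> U" "y \<in> V" "disjnt U V"
      using \<open>Hausdorff_space X\<close> unfolding Hausdorff_space_def by metis
    then have "U \<in> M \<or> V \<in> M"
      using maximalideal_power_set_ring_disjoint[OF max] by (simp add: openin_subset disjnt_def)
    moreover have "U \<notin> M" "V \<notin> M"
      using conv UV by (simp_all add: ideal_converges_to_def)
    ultimately show False by blast
  qed
next
  assume unique: "\<forall>M. maximalideal M (power_set_ring (topspace X)) \<longrightarrow>
      (\<forall>x y. ideal_converges_to X M x \<and> ideal_converges_to X M y \<longrightarrow> x = y)"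
  interpret cring "power_set_ring (topspace X)" by (rule power_set_ring_cring)
  show "Hausdorff_space X"
    unfolding Hausdorff_space_def
  proof (intro allI impI)
    fix x y
    assume xy: "x \<in> topspace X \<and> y \<in> topspace X \<and> x \<noteq> y"
    show "\<exists>U V. openin X U \<and> openin X V \<and> x \<in> U \<and> y \<in> V \<and> disjnt U V"
    proof (rule ccontr)
      assume "\<not> ?thesis"
      then have "\<one>\<^bsub>power_set_ring (topspace X)\<^esub> \<notin> joint_nonneighbourhoods X x y"
        by (simp add: power_set_ring_def topspace_in_joint_nonneighbourhoods_iff)
      then obtain M where "maximalideal M (power_set_ring (topspace X))"
        and "joint_nonneighbourhoods X x y \<subseteq> M"
        using proper_ideal_subset_maximalideal[OF ideal_joint_nonneighbourhoods[of x X y]] xy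
        by metis
      then have "ideal_converges_to X M x" "ideal_converges_to X M y"
        using maximalideal_converges_to_both[of x X y M] xy by simp_all
      with unique \<open>maximalideal M _\<close> have "x = y" by metis
      with xy show False by simp
    qed
  qed
qed

end
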